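(* Consider the RLC circuit $-L\dot I=\Gamma V+RI-Bu_s$, $C\dot V=\Gamma^\top I-GV$ and its extended dynamics (adjoining $-L\ddot I=\Gamma\dot V+R\dot I-B\upsilon_s$, $C\ddot V=\Gamma^\top\dot I-G\dot V$, $\dot u_s=\upsilon_s$), with extended state $(I,V,\dot I,\dot V,u_s)$ and input $\upsilon_s\in\mathbb{R}^m$. Assume: $L,C$ constant symmetric positive definite; $R,G$ symmetric positive semi-definite; $I,V$ (and $\dot I,\dot V$) are measured; and there exist constants $V^\star\in\mathbb{R}^\rho_+$, $\bar u_s\in\mathbb{R}^m$ and $\bar I\in\mathbb{R}^\sigma$ with $0=\Gamma V^\star+R\bar I-B\bar u_s$, $0=\Gamma^\top\bar I-GV^\star$. Apply the control $$\upsilon_s=\frac1{k_d}\big(\mu_s-k_i(u_s-\bar u_s)-y_s\big),\qquad y_s=B^\top\dot I,$$ with $k_d>0$, $k_i>0$ and new input $\mu_s\in\mathbb{R}^m$. Then: (a) the closed-loop system defines a passive map $\mu_s\mapsto\dot u_s$; (b) if $\mu_s=0$ and any of (i) $R>0$ and $G>0$; (ii) $R>0$ and $\Gamma$ has full column rank; (iii) $G>0$ and $\Gamma^\top$ has full column rank holds, then the solution of the closed-loop system asymptotically converges to the set $\{(I,V,\dot I,\dot V,u_s):\dot V=0,\dot I=0,\dot u_s=0,u_s=\bar u_s\}$; (c) if, in addition to one of the conditions in (b) (with $\mu_s=0$), the matrix $\mathcal{A}_s=\begin{bmatrix}R&\Gamma\\\Gamma^\top&-G\end{bmatrix}$ has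 full rank, then the solution of the closed-loop system asymptotically converges to the desired operating point $(\bar I,V^\star,0,0,\bar u_s)$, which is unique.
   Context: $I\in\mathbb{R}^\sigma$, $V\in\mathbb{R}^\rho$, $u_s\in\mathbb{R}^m$; $\Gamma\in\mathbb{R}^{\sigma\times\rho}$; $B\in\mathbb{R}^{\sigma\times m}$ has full column rank. A map $\mu\mapsto z$ is passive if there is a storage function $S\ge0$ of the closed-loop state with $\dot S\le\mu^\top z$ along trajectories. *)

theory Defs
  imports "HOL-Analysis.Analysis"
begin

text \<open>Symmetric positive definite / positive semi-definite real matrices.\<close>
definition pos_def_mat :: "real^'n^'n \<Rightarrow> bool" where
  "pos_def_mat M \<longleftrightarrow> transpose M = M \<and> (\<forall>x. x \<noteq> 0 \<longrightarrow> 0 < x \<bullet> (M *v x))"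

definition psd_mat :: "real^'n^'n \<Rightarrow> bool" where
  "psd_mat M \<longleftrightarrow> transpose M = M \<and> (\<forall>x. 0 \<le> x \<bullet> (M *v x))"

text \<open>The control law upsilon_s = (1/k_d)(mu_s - k_i (u_s - ubar) - y_s), y_s = B^T Idot.\<close>
definition ctrl_law :: "real \<Rightarrow> real \<Rightarrow> real^'m \<Rightarrow> real^'m^'s \<Rightarrow> real^'m \<Rightarrow> real^'m \<Rightarrow> real^'s \<Rightarrow> real^'m"
  where "ctrl_law kd ki ub B mu us Jd = (1 / kd) *\<^sub>R (mu - ki *\<^sub>R (us - ub) - transpose B *v Jd)"

text \<open>A solution on [0,\<infinity>) of the closed-loop extended system (state (I,V,Idot,Vdot,u_s)),
  with new input mu. The components Jd, Vd are the time derivatives of I, V; the original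
  circuit equations hold together with the extended (differentiated) dynamics and u_s' = upsilon_s.\<close>
definition closed_loop_sol ::
  "real^'s^'s \<Rightarrow> real^'r^'r \<Rightarrow> real^'s^'s \<Rightarrow> real^'r^'r \<Rightarrow> real^'r^'s \<Rightarrow> real^'m^'s \<Rightarrow>
   real \<Rightarrow> real \<Rightarrow> real^'m \<Rightarrow> (real \<Rightarrow> real^'m) \<Rightarrow>
   (real \<Rightarrow> real^'s) \<Rightarrow> (real \<Rightarrow> real^'r) \<Rightarrow> (real \<Rightarrow> real^'s) \<Rightarrow> (real \<Rightarrow> real^'r) \<Rightarrow> (real \<Rightarrow> real^'m) \<Rightarrow> bool"
  where "closed_loop_sol L C R G \<Gamma> B kd ki ub mu I V Jd Vd u \<longleftrightarrow>
    (\<exists>Jdd Vdd. \<forall>t\<ge>0.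
       (I has_vector_derivative Jd t) (at t within {0..}) \<and>
       (V has_vector_derivative Vd t) (at t within {0..}) \<and>
       (Jd has_vector_derivative Jdd t) (at t within {0..}) \<and>
       (Vd has_vector_derivative Vdd t) (at t within {0..}) \<and>
       (u has_vector_derivative ctrl_law kd ki ub B (mu t) (u t) (Jd t)) (at t within {0..}) \<and>
       - (L *v Jd t) = \<Gamma> *v V t + R *v I t - B *v u t \<and>
       C *v Vd t = transpose \<Gamma> *v I t - G *v V t \<and>
       - (L *v Jdd t) = \<Gamma> *v Vd t + R *v Jd t - B *v ctrl_law kd ki ub B (mu t) (u t) (Jd t) \<and>
       C *v Vdd t = transpose \<Gamma> *v Jd t - G *v Vd t)"

text \<open>Block matrix A_s = [R, Gamma; Gamma^T, -G], indexed by 's + 'r.\<close>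
definition block_As :: "real^'s^'s \<Rightarrow> real^'r^'s \<Rightarrow> real^'r^'r \<Rightarrow> real^('s + 'r)^('s + 'r)" where
  "block_As R \<Gamma> G = (\<chi> i j. case i of
      Inl a \<Rightarrow> (case j of Inl b \<Rightarrow> R $ a $ b | Inr b \<Rightarrow> \<Gamma> $ a $ b)
    | Inr a \<Rightarrow> (case j of Inl b \<Rightarrow> \<Gamma> $ b $ a | Inr b \<Rightarrow> - (G $ a $ b)))"

end

theory Submission
  imports Defs
begin

text \<open>
  Write x = dI/dt, y = dV/dt and w = u_s - ub. Along the extended dynamics the stored energy
  S = (x'Lx + y'Cy + k_i |w|^2) / 2 satisfies dS/dt = mu'v - k_d |v|^2 - x'Rx - y'Gy with
  v = du_s/dt: the \<Gamma>-terms cancel, and the control law turns k_i w'v + (B'x)'v into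
  (mu - k_d v)'v. This is the passivity claim.

  For mu = 0 the dissipation k_d |v|^2 + x'Rx + y'Gy controls only the variables on which R or G
  is definite. The missing one is controlled by a cross term, (Lx)'(\<Gamma>y) if R > 0 and (Cy)'(-\<Gamma>'x)
  if G > 0, whose derivative is -|\<Gamma>y|^2 (resp. -|\<Gamma>'x|^2) up to terms dominated by the
  dissipation. For small eps, S + eps W is then a strict Lyapunov function comparable to S, so S
  decays exponentially and x, y, w tend to 0. Finally
  A_s (I - Ib, V - Vstar) = (B w - L x, C y) tends to 0, and A_s is invertible.
\<close>

section \<open>Matrix estimates\<close>

lemma inner_matrix_vector_transpose:
  fixes A :: "real^'n^'m"
  shows "x \<bullet> (A *v y) = (transpose A *v x) \<bullet> y"
  by (simp add: transpose_matrix_vector dot_lmul_matrix)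

lemma norm_matrix_vector_le_onorm:
  fixes A :: "real^'n^'m"
  shows "norm (A *v x) \<le> onorm ((*v) A) * norm x"
  by (rule onorm[OF matrix_vector_mul_bounded_linear])

lemma onorm_matrix_nonneg: "0 \<le> onorm ((*v) (A :: real^'n^'m))"
  by (rule onorm_pos_le[OF matrix_vector_mul_bounded_linear])

lemma norm_matrix_vector_le:
  fixes A :: "real^'n^'m"
  assumes "onorm ((*v) A) \<le> K"
  shows "norm (A *v x) \<le> K * norm x"
  using norm_matrix_vector_le_onorm[of A x] mult_right_mono[OF assms norm_ge_zero[of x]] by linarith

lemma inner_matrix_vector_le:
  fixes A :: "real^'n^'n"
  shows "x \<bullet> (A *v x) \<le> onorm ((*v) A) * (norm x)\<^sup>2"
  using Cauchy_Schwarz_ineq2[of x "A *v x"] mult_left_mono[OF norm_matrix_vector_le_onorm[of A x] norm_ge_zero[of x]]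
  by (simp add: power2_eq_square abs_le_iff algebra_simps)

lemma tendsto_matrix_vector_mult [tendsto_intros]:
  fixes A :: "real^'n^'m"
  shows "(f \<longlongrightarrow> a) F \<Longrightarrow> ((\<lambda>t. A *v f t) \<longlongrightarrow> A *v a) F"
  by (rule bounded_linear.tendsto[OF matrix_vector_mul_bounded_linear])

lemma matrix_inj_norm_ge:
  fixes A :: "real^'n^'m"
  assumes "inj ((*v) A)"
  obtains \<gamma> where "\<gamma> > 0" "\<And>x. \<gamma> * norm x \<le> norm (A *v x)"
  using linear_inj_bounded_below_pos[OF matrix_vector_mul_linear assms] by blast

lemma matrix_inj_tendsto_zero:
  fixes A :: "real^'n^'m"
  assumes "inj ((*v) A)" and "((\<lambda>t. A *v z t) \<longlongrightarrow> 0) F"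
  shows "(z \<longlongrightarrow> 0) F"
proof -
  obtain \<gamma> where \<gamma>: "\<gamma> > 0" "\<And>x. \<gamma> * norm x \<le> norm (A *v x)"
    using matrix_inj_norm_ge[OF assms(1)] by blast
  show ?thesis
  proof (rule Lim_null_comparison)
    show "\<forall>\<^sub>F t in F. norm (z t) \<le> norm (A *v z t) / \<gamma>"
      using \<gamma> by (intro always_eventually allI) (simp add: field_simps mult.commute)
    show "((\<lambda>t. norm (A *v z t) / \<gamma>) \<longlongrightarrow> 0) F"
      by (intro tendsto_divide_zero tendsto_norm_zero assms(2))
  qed
qed

lemma pos_def_mat_imp_psd_mat:
  assumes "pos_def_mat M"
  shows "psd_mat M"
  unfolding psd_mat_def
proof (intro conjI allI)
  show "transpose M = M"
    using assms by (simp add: pos_def_mat_def)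
  show "0 \<le> x \<bullet> (M *v x)" for x
    using assms unfolding pos_def_mat_def by (cases "x = 0") (auto intro: less_imp_le)
qed

lemma pos_def_mat_inj:
  assumes "pos_def_mat M"
  shows "inj ((*v) M)"
proof -
  have "x = 0" if "M *v x = 0" for x
  proof -
    have "\<not> 0 < x \<bullet> (M *v x)"
      using that by simp
    then show "x = 0"
      using assms unfolding pos_def_mat_def by blast
  qed
  then show ?thesis
    by (simp add: linear_injective_0[OF matrix_vector_mul_linear])
qed

lemma pos_def_mat_quadratic_ge:
  fixes M :: "real^'n^'n"
  assumes "pos_def_mat M"
  obtains l where "l > 0" "\<And>x. l * (norm x)\<^sup>2 \<le> x \<bullet> (M *v x)"
proof -
  let ?q = "\<lambda>x::real^'n. x \<bullet> (M *v x)"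
  have "continuous_on (sphere 0 1) ?q"
    by (intro continuous_intros)
  moreover have "sphere (0::real^'n) 1 \<noteq> {}"
    using vector_choose_size[of 1] by auto
  ultimately obtain x0 where x0: "x0 \<in> sphere 0 1" "\<And>x. x \<in> sphere 0 1 \<Longrightarrow> ?q x0 \<le> ?q x"
    using continuous_attains_inf[OF compact_sphere] by blast
  have "?q x0 * (norm x)\<^sup>2 \<le> ?q x" for x
  proof (cases "x = 0")
    case False
    have "?q (x /\<^sub>R norm x) = ?q x / (norm x)\<^sup>2"
      by (simp add: matrix_vector_mult_scaleR power2_eq_square divide_inverse)
    with x0(2)[of "x /\<^sub>R norm x"] False show ?thesis
      by (simp add: le_divide_eq)
  qed simp
  moreover have "x0 \<noteq> 0"
    using x0(1) by auto
  then have "?q x0 > 0"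
    using assms unfolding pos_def_mat_def by blast
  ultimately show ?thesis
    using that by blast
qed

lemma has_real_derivative_inner:
  assumes "(f has_vector_derivative f') (at t within T)" and "(g has_vector_derivative g') (at t within T)"
  shows "((\<lambda>t. f t \<bullet> g t) has_real_derivative f t \<bullet> g' + f' \<bullet> g t) (at t within T)"
  using bounded_bilinear.has_vector_derivative[OF bounded_bilinear_inner assms]
  by (simp add: has_real_derivative_iff_has_vector_derivative)

lemma has_vector_derivative_matrix_vector_mult:
  fixes A :: "real^'n^'m"
  assumes "(f has_vector_derivative f') F"
  shows "((\<lambda>t. A *v f t) has_vector_derivative A *v f') F"
  by (rule bounded_linear.has_vector_derivative[OF matrix_vector_mul_bounded_linear assms])

lemma has_real_derivative_quadratic_form:
  fixes M :: "real^'n^'n"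
  assumes "transpose M = M" and "(f has_vector_derivative f') (at t within T)"
  shows "((\<lambda>t. f t \<bullet> (M *v f t)) has_real_derivative 2 * (f t \<bullet> (M *v f'))) (at t within T)"
proof -
  have sym: "f' \<bullet> (M *v f t) = f t \<bullet> (M *v f')"
    using inner_matrix_vector_transpose[of f' M "f t"] assms(1) by (simp add: inner_commute)
  from has_real_derivative_inner[OF assms(2) has_vector_derivative_matrix_vector_mult[OF assms(2), of M]]
  show ?thesis
    by (rule DERIV_cong) (simp add: sym)
qed

section \<open>Exponential decay from a cross-term Lyapunov function\<close>

lemma exp_decay_of_deriv_le:
  fixes f f' :: "real \<Rightarrow> real"
  assumes f': "\<And>t. 0 \<le> t \<Longrightarrow> (f has_real_derivative f' t) (at t within {0..})"
    and le: "\<And>t. 0 \<le> t \<Longrightarrow> f' t \<le> - r * f t" and "0 \<le> t"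
  shows "f t \<le> f 0 * exp (- r * t)"
proof -
  define h where "h s = f s * exp (r * s)" for s
  have h': "(h has_real_derivative (f' s + r * f s) * exp (r * s)) (at s within {0..})" if "0 \<le> s" for s
  proof -
    have "((\<lambda>s. exp (r * s)) has_real_derivative exp (r * s) * r) (at s within {0..})"
      by (auto intro!: derivative_eq_intros)
    from DERIV_mult[OF f'[OF that] this] show ?thesis
      unfolding h_def by (rule DERIV_cong) (simp add: algebra_simps)
  qed
  have "h t \<le> h 0"
  proof (rule DERIV_nonpos_imp_decreasing_open[OF \<open>0 \<le> t\<close>])
    fix s assume s: "0 < s" "s < t"
    have "at s within {0..} = at s"
      using s by (intro at_within_interior) auto
    then have "(h has_real_derivative (f' s + r * f s) * exp (r * s)) (at s)"
      using h'[of s] s by simp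
    moreover have "(f' s + r * f s) * exp (r * s) \<le> 0"
      using le[of s] s by (simp add: mult_nonpos_nonneg)
    ultimately show "\<exists>y. (h has_real_derivative y) (at s) \<and> y \<le> 0"
      by blast
  next
    show "continuous_on {0..t} h"
      unfolding continuous_on_eq_continuous_within
    proof
      fix s :: real
      assume "s \<in> {0..t}"
      then show "continuous (at s within {0..t}) h"
        by (intro continuous_within_subset[OF DERIV_continuous[OF h'[of s]]]) auto
    qed
  qed
  then show ?thesis
    by (simp add: h_def exp_minus field_simps)
qed

lemma exp_neg_mult_tendsto_zero:
  assumes "0 < r"
  shows "((\<lambda>t::real. exp (- r * t)) \<longlongrightarrow> 0) at_top"
proof -
  have "filterlim (\<lambda>t. exp (r * t)) at_top at_top"
    by (rule filterlim_compose[OF exp_at_top filterlim_tendsto_pos_mult_at_top[OF tendsto_const assms filterlim_ident]])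
  then show ?thesis
    by (simp add: exp_minus tendsto_inverse_0_at_top)
qed

lemma square_sum_le: "(a + b)\<^sup>2 \<le> 2 * (a\<^sup>2 + b\<^sup>2)" for a b :: real
  unfolding power2_sum using sum_squares_bound[of a b] by argo

lemma mult_le_weighted_squares:
  fixes g K k m :: real
  assumes "0 < g"
  shows "K * k * m \<le> g / 2 * m\<^sup>2 + K\<^sup>2 / (2 * g) * k\<^sup>2"
proof -
  have "2 * g * (K * k * m) \<le> g\<^sup>2 * m\<^sup>2 + K\<^sup>2 * k\<^sup>2"
    using sum_squares_bound[of "g * m" "K * k"] by (simp add: power2_eq_square algebra_simps)
  then show ?thesis
    using assms by (simp add: field_simps power2_eq_square)
qed

lemma weighted_sum_sq_ge:
  fixes p q a b :: real
  assumes "0 < p" "0 < q"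
  shows "min p q / 2 * (a + b)\<^sup>2 \<le> p * a\<^sup>2 + q * b\<^sup>2"
proof -
  have "min p q * (a + b)\<^sup>2 \<le> min p q * (2 * (a\<^sup>2 + b\<^sup>2))"
    using assms square_sum_le by (intro mult_left_mono) auto
  then have "min p q / 2 * (a + b)\<^sup>2 \<le> min p q * a\<^sup>2 + min p q * b\<^sup>2"
    by (simp add: algebra_simps)
  also have "\<dots> \<le> p * a\<^sup>2 + q * b\<^sup>2"
    by (intro add_mono mult_right_mono) simp_all
  finally show ?thesis .
qed

lemma weighted_sum_sq_ge3:
  fixes p q s a b e :: real
  assumes "0 < p" "0 < q" "0 < s"
  shows "min p (min q s) / 3 * (a + b + e)\<^sup>2 \<le> p * a\<^sup>2 + q * b\<^sup>2 + s * e\<^sup>2"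
proof -
  have "(a + b + e)\<^sup>2 \<le> 3 * (a\<^sup>2 + b\<^sup>2 + e\<^sup>2)"
    using zero_le_power2[of "a - b"] zero_le_power2[of "b - e"] zero_le_power2[of "a - e"]
    by (simp add: power2_eq_square algebra_simps)
  then have "min p (min q s) * (a + b + e)\<^sup>2 \<le> min p (min q s) * (3 * (a\<^sup>2 + b\<^sup>2 + e\<^sup>2))"
    using assms by (intro mult_left_mono) auto
  then have "min p (min q s) / 3 * (a + b + e)\<^sup>2
      \<le> min p (min q s) * a\<^sup>2 + min p (min q s) * b\<^sup>2 + min p (min q s) * e\<^sup>2"
    by (simp add: algebra_simps)
  also have "\<dots> \<le> p * a\<^sup>2 + q * b\<^sup>2 + s * e\<^sup>2"
    by (intro add_mono mult_right_mono) simp_all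
  finally show ?thesis .
qed

lemma strict_lyapunov_pointwise:
  fixes k m S W S' W' :: real
  assumes "0 < b" "0 < g" "0 < \<epsilon>" "2 * \<epsilon> * a \<le> 1" "\<epsilon> * (\<bar>K\<bar> + K\<^sup>2 / (2 * g)) \<le> d / 2"
    and "0 \<le> k" "0 \<le> m" "0 \<le> S" "\<bar>W\<bar> \<le> a * S" "S \<le> b * (k + m)\<^sup>2"
    and "S' \<le> - d * k\<^sup>2" "W' \<le> - g * m\<^sup>2 + K * k * (k + m)"
  shows "S \<le> 2 * (S + \<epsilon> * W)"
    and "S' + \<epsilon> * W' \<le> - (min (d / 2) (\<epsilon> * g / 2) / (3 * b)) * (S + \<epsilon> * W)"
proof -
  have "\<bar>\<epsilon> * W\<bar> \<le> \<epsilon> * a * S"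
    using assms(3,9) by (simp add: abs_mult mult_left_mono mult.assoc)
  also have "\<dots> \<le> 1 / 2 * S"
    using assms(4,8) by (intro mult_right_mono) auto
  finally have small: "\<bar>\<epsilon> * W\<bar> \<le> S / 2"
    by simp
  then show "S \<le> 2 * (S + \<epsilon> * W)"
    unfolding abs_le_iff by auto
  define A where "A = \<bar>K\<bar> + K\<^sup>2 / (2 * g)"
  define \<delta> where "\<delta> = min (d / 2) (\<epsilon> * g / 2)"
  have "0 \<le> \<epsilon> * A"
    using assms(2,3) unfolding A_def by simp
  then have "0 \<le> \<delta>"
    using assms(2,3,5) unfolding \<delta>_def A_def[symmetric] by simp
  have "K * k * k \<le> \<bar>K\<bar> * k\<^sup>2"
    using mult_right_mono[OF abs_ge_self[of K], of "k * k"] by (simp add: power2_eq_square mult.assoc)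
  with mult_le_weighted_squares[OF assms(2), of K k m]
  have "- g * m\<^sup>2 + K * k * (k + m) \<le> - g / 2 * m\<^sup>2 + A * k\<^sup>2"
    unfolding A_def by (simp add: algebra_simps)
  then have "\<epsilon> * W' \<le> \<epsilon> * (- g / 2 * m\<^sup>2 + A * k\<^sup>2)"
    using assms(3,12) by (meson mult_left_mono order.trans less_imp_le)
  moreover have "\<epsilon> * A * k\<^sup>2 \<le> d / 2 * k\<^sup>2"
    using assms(5) unfolding A_def by (intro mult_right_mono) auto
  moreover have "\<delta> * k\<^sup>2 \<le> d / 2 * k\<^sup>2" "\<delta> * m\<^sup>2 \<le> \<epsilon> * g / 2 * m\<^sup>2"
    unfolding \<delta>_def by (intro mult_right_mono; simp)+
  ultimately have "S' + \<epsilon> * W' \<le> - \<delta> * (k\<^sup>2 + m\<^sup>2)"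
    using assms(11) by (simp add: algebra_simps)
  also have "\<dots> \<le> - \<delta> / 2 * (k + m)\<^sup>2"
    using mult_left_mono[OF square_sum_le \<open>0 \<le> \<delta>\<close>, of k m] by (simp add: field_simps)
  also have "\<dots> \<le> - (\<delta> / (3 * b)) * (S + \<epsilon> * W)"
  proof -
    have "S + \<epsilon> * W \<le> 3 / 2 * b * (k + m)\<^sup>2"
      using small assms(10) unfolding abs_le_iff by auto
    moreover have "0 \<le> \<delta> / (3 * b)"
      using \<open>0 \<le> \<delta>\<close> assms(1) by simp
    ultimately have "\<delta> / (3 * b) * (S + \<epsilon> * W) \<le> \<delta> / (3 * b) * (3 / 2 * b * (k + m)\<^sup>2)"
      by (rule mult_left_mono)
    then show ?thesis
      using assms(1) by simp
  qed
  finally show "S' + \<epsilon> * W' \<le> - (min (d / 2) (\<epsilon> * g / 2) / (3 * b)) * (S + \<epsilon> * W)"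
    unfolding \<delta>_def .
qed

text \<open>
  S alone only dissipates k; W dissipates m at the price of terms of order k (k + m). Mixing in
  eps W with eps small keeps S + eps W comparable to S and makes its decay rate proportional to it.
\<close>

lemma strict_lyapunov_tendsto_zero:
  fixes S W S' W' k m :: "real \<Rightarrow> real"
  assumes "0 \<le> a" "0 < b" "0 < d" "0 < g"
    and S': "\<And>t. 0 \<le> t \<Longrightarrow> (S has_real_derivative S' t) (at t within {0..})"
    and W': "\<And>t. 0 \<le> t \<Longrightarrow> (W has_real_derivative W' t) (at t within {0..})"
    and k: "\<And>t. 0 \<le> t \<Longrightarrow> 0 \<le> k t" and m: "\<And>t. 0 \<le> t \<Longrightarrow> 0 \<le> m t"
    and S_nonneg: "\<And>t. 0 \<le> t \<Longrightarrow> 0 \<le> S t"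
    and W_le: "\<And>t. 0 \<le> t \<Longrightarrow> \<bar>W t\<bar> \<le> a * S t"
    and S_le: "\<And>t. 0 \<le> t \<Longrightarrow> S t \<le> b * (k t + m t)\<^sup>2"
    and S'_le: "\<And>t. 0 \<le> t \<Longrightarrow> S' t \<le> - d * (k t)\<^sup>2"
    and W'_le: "\<And>t. 0 \<le> t \<Longrightarrow> W' t \<le> - g * (m t)\<^sup>2 + K * k t * (k t + m t)"
  shows "(S \<longlongrightarrow> 0) at_top"
proof -
  define A where "A = \<bar>K\<bar> + K\<^sup>2 / (2 * g)"
  define \<epsilon> where "\<epsilon> = min (1 / (2 * a + 2)) (d / (2 * A + 2))"
  define r where "r = min (d / 2) (\<epsilon> * g / 2) / (3 * b)"
  have "0 \<le> A"
    unfolding A_def using assms(4) by simp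
  then have "0 < \<epsilon>"
    unfolding \<epsilon>_def using assms(1,3) by simp
  have "\<epsilon> \<le> 1 / (2 * a + 2)"
    unfolding \<epsilon>_def by simp
  then have "\<epsilon> * (2 * a + 2) \<le> 1"
    using assms(1) by (simp add: pos_le_divide_eq)
  then have "2 * \<epsilon> * a \<le> 1"
    using \<open>0 < \<epsilon>\<close> by (simp add: algebra_simps)
  have "\<epsilon> \<le> d / (2 * A + 2)"
    unfolding \<epsilon>_def by simp
  then have "\<epsilon> * (2 * A + 2) \<le> d"
    using \<open>0 \<le> A\<close> by (simp add: pos_le_divide_eq)
  then have "\<epsilon> * A \<le> d / 2"
    using \<open>0 < \<epsilon>\<close> by (simp add: algebra_simps)
  have pointwise: "S t \<le> 2 * (S t + \<epsilon> * W t)" "S' t + \<epsilon> * W' t \<le> - r * (S t + \<epsilon> * W t)"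
    if "0 \<le> t" for t
    using strict_lyapunov_pointwise[OF assms(2,4) \<open>0 < \<epsilon>\<close> \<open>2 * \<epsilon> * a \<le> 1\<close>
        \<open>\<epsilon> * A \<le> d / 2\<close>[unfolded A_def] k[OF that] m[OF that] S_nonneg[OF that] W_le[OF that]
        S_le[OF that] S'_le[OF that] W'_le[OF that]]
    unfolding r_def by auto
  have "0 < r"
    using \<open>0 < \<epsilon>\<close> assms(2-4) unfolding r_def by simp
  have decay: "S t + \<epsilon> * W t \<le> (S 0 + \<epsilon> * W 0) * exp (- r * t)" if "0 \<le> t" for t
  proof (rule exp_decay_of_deriv_le[OF _ _ that])
    show "((\<lambda>t. S t + \<epsilon> * W t) has_real_derivative S' s + \<epsilon> * W' s) (at s within {0..})"
      if "0 \<le> s" for s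
      using S'[OF that] W'[OF that] by (intro DERIV_add DERIV_cmult)
    show "S' s + \<epsilon> * W' s \<le> - r * (S s + \<epsilon> * W s)" if "0 \<le> s" for s
      using pointwise(2)[OF that] .
  qed
  show ?thesis
  proof (rule tendsto_sandwich[OF _ _ tendsto_const])
    show "\<forall>\<^sub>F t in at_top. 0 \<le> S t"
      using eventually_ge_at_top[of 0] by (rule eventually_mono) (rule S_nonneg)
    show "\<forall>\<^sub>F t in at_top. S t \<le> 2 * ((S 0 + \<epsilon> * W 0) * exp (- r * t))"
      using eventually_ge_at_top[of 0]
    proof (rule eventually_mono)
      fix t :: real
      assume "0 \<le> t"
      then show "S t \<le> 2 * ((S 0 + \<epsilon> * W 0) * exp (- r * t))"
        using order_trans[OF pointwise(1) mult_left_mono[OF decay]] by simp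
    qed
    show "((\<lambda>t. 2 * ((S 0 + \<epsilon> * W 0) * exp (- r * t))) \<longlongrightarrow> 0) at_top"
      by (intro tendsto_mult_right_zero exp_neg_mult_tendsto_zero \<open>0 < r\<close>)
  qed
qed

section \<open>The stored energy and passivity\<close>

definition storage ::
  "real^'s^'s \<Rightarrow> real^'r^'r \<Rightarrow> real \<Rightarrow> real^'m \<Rightarrow> real^'s \<Rightarrow> real^'r \<Rightarrow> real^'m \<Rightarrow> real"
  where "storage L C ki ub x y u = (x \<bullet> (L *v x) + y \<bullet> (C *v y) + ki * ((u - ub) \<bullet> (u - ub))) / 2"

lemma storage_nonneg:
  assumes "psd_mat L" "psd_mat C" "0 \<le> ki"
  shows "0 \<le> storage L C ki ub x y u"
  using assms unfolding storage_def psd_mat_def by simp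

lemma storage_ge_norm:
  fixes L :: "real^'s^'s" and C :: "real^'r^'r"
  assumes "pos_def_mat L" "pos_def_mat C" "0 < ki"
  obtains l where "0 < l" "\<And>x y u. l * (norm (x, y, u - ub))\<^sup>2 \<le> storage L C ki ub x y u"
proof -
  obtain l1 where l1: "0 < l1" "\<And>x. l1 * (norm x)\<^sup>2 \<le> x \<bullet> (L *v x)"
    using pos_def_mat_quadratic_ge[OF assms(1)] by blast
  obtain l2 where l2: "0 < l2" "\<And>y. l2 * (norm y)\<^sup>2 \<le> y \<bullet> (C *v y)"
    using pos_def_mat_quadratic_ge[OF assms(2)] by blast
  define l where "l = min (min l1 l2) ki / 2"
  have "l * (norm (x, y, u - ub))\<^sup>2 \<le> storage L C ki ub x y u" for x y u
  proof -
    have "2 * l * (norm x)\<^sup>2 \<le> l1 * (norm x)\<^sup>2" "2 * l * (norm y)\<^sup>2 \<le> l2 * (norm y)\<^sup>2"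
      "2 * l * (norm (u - ub))\<^sup>2 \<le> ki * (norm (u - ub))\<^sup>2"
      unfolding l_def by (intro mult_right_mono; simp)+
    moreover have "(norm (x, y, u - ub))\<^sup>2 = (norm x)\<^sup>2 + (norm y)\<^sup>2 + (norm (u - ub))\<^sup>2"
      by (simp add: norm_Pair)
    moreover have "storage L C ki ub x y u = (x \<bullet> (L *v x) + y \<bullet> (C *v y) + ki * (norm (u - ub))\<^sup>2) / 2"
      by (simp add: storage_def power2_norm_eq_inner)
    ultimately show ?thesis
      using l1(2)[of x] l2(2)[of y] by (simp add: algebra_simps)
  qed
  moreover have "0 < l"
    unfolding l_def using l1 l2 assms(3) by simp
  ultimately show ?thesis
    using that by blast
qed

lemma control_error_norm_le:
  fixes B :: "real^'m^'s"
  assumes "kd *\<^sub>R v = - ki *\<^sub>R w - transpose B *v x" "0 \<le> ki" "0 \<le> kd"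
  shows "ki * norm w \<le> kd * norm v + onorm ((*v) (transpose B)) * norm x"
proof -
  have "ki * norm w = norm (kd *\<^sub>R v + transpose B *v x)"
    using assms by simp
  also have "\<dots> \<le> kd * norm v + onorm ((*v) (transpose B)) * norm x"
    using norm_triangle_ineq[of "kd *\<^sub>R v" "transpose B *v x"]
      norm_matrix_vector_le_onorm[of "transpose B" x] assms(3)
    by simp
  finally show ?thesis .
qed

lemma storage_le_under_control:
  fixes L :: "real^'s^'s" and C :: "real^'r^'r" and B :: "real^'m^'s"
  assumes "0 < kd" "0 < ki" "0 < \<beta>"
  obtains c where "0 < c"
    "\<And>x y u v. kd *\<^sub>R v = - ki *\<^sub>R (u - ub) - transpose B *v x \<Longrightarrow>
       storage L C ki ub x y u \<le> c * (norm x + norm y + \<beta> * norm v)\<^sup>2"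
proof -
  define P where "P = (kd / \<beta> + onorm ((*v) (transpose B))) / ki"
  define c where "c = (onorm ((*v) L) + onorm ((*v) C) + ki * P\<^sup>2) / 2 + 1"
  have "storage L C ki ub x y u \<le> c * (norm x + norm y + \<beta> * norm v)\<^sup>2"
    if control: "kd *\<^sub>R v = - ki *\<^sub>R (u - ub) - transpose B *v x" for x y u v
  proof -
    define N where "N = norm x + norm y + \<beta> * norm v"
    have x: "norm x \<le> N" and y: "norm y \<le> N" and v: "kd * norm v \<le> kd / \<beta> * N"
      using assms by (auto simp: N_def field_simps)
    have "ki * norm (u - ub) \<le> kd / \<beta> * N + onorm ((*v) (transpose B)) * N"
      using control_error_norm_le[OF control] assms(1,2) v
        mult_left_mono[OF x onorm_matrix_nonneg[of "transpose B"]]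
      by linarith
    also have "\<dots> = ki * (P * N)"
      unfolding P_def using assms(2) by (simp add: field_simps)
    finally have w: "norm (u - ub) \<le> P * N"
      using assms(2) by simp
    have "x \<bullet> (L *v x) \<le> onorm ((*v) L) * N\<^sup>2"
      using inner_matrix_vector_le[of x L]
        mult_left_mono[OF power_mono[OF x norm_ge_zero, of 2] onorm_matrix_nonneg[of L]]
      by linarith
    moreover have "y \<bullet> (C *v y) \<le> onorm ((*v) C) * N\<^sup>2"
      using inner_matrix_vector_le[of y C]
        mult_left_mono[OF power_mono[OF y norm_ge_zero, of 2] onorm_matrix_nonneg[of C]]
      by linarith
    moreover have "ki * ((u - ub) \<bullet> (u - ub)) \<le> ki * (P\<^sup>2 * N\<^sup>2)"
      using power_mono[OF w norm_ge_zero, of 2] assms(2)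
      by (simp add: power2_norm_eq_inner power_mult_distrib)
    moreover have "c * N\<^sup>2 = (onorm ((*v) L) * N\<^sup>2 + onorm ((*v) C) * N\<^sup>2 + ki * (P\<^sup>2 * N\<^sup>2)) / 2 + N\<^sup>2"
      unfolding c_def by (simp add: algebra_simps)
    ultimately show ?thesis
      unfolding storage_def N_def[symmetric] using zero_le_power2[of N] by argo
  qed
  moreover have "0 < c"
    using onorm_matrix_nonneg[of L] onorm_matrix_nonneg[of C]
      mult_nonneg_nonneg[OF less_imp_le[OF assms(2)] zero_le_power2[of P]]
    unfolding c_def by argo
  ultimately show ?thesis
    using that by blast
qed

lemma ctrl_law_scaled:
  assumes "kd \<noteq> 0"
  shows "kd *\<^sub>R ctrl_law kd ki ub B mu u x = mu - ki *\<^sub>R (u - ub) - transpose B *v x"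
  using assms by (simp add: ctrl_law_def)

lemma storage_power_balance:
  fixes L R :: "real^'s^'s" and C G :: "real^'r^'r" and \<Gamma> :: "real^'r^'s" and B :: "real^'m^'s"
  assumes eq_x': "- (L *v x') = \<Gamma> *v y + R *v x - B *v v"
    and eq_y': "C *v y' = transpose \<Gamma> *v x - G *v y"
    and control: "kd *\<^sub>R v = \<mu> - ki *\<^sub>R (u - ub) - transpose B *v x"
  shows "x \<bullet> (L *v x') + y \<bullet> (C *v y') + ki * ((u - ub) \<bullet> v)
    = \<mu> \<bullet> v - kd * (v \<bullet> v) - x \<bullet> (R *v x) - y \<bullet> (G *v y)"
proof -
  have "x \<bullet> (L *v x') = - (x \<bullet> (\<Gamma> *v y)) - x \<bullet> (R *v x) + (transpose B *v x) \<bullet> v"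
    using arg_cong[OF eq_x', of "inner x"]
    by (simp add: inner_diff_right inner_add_right inner_matrix_vector_transpose[of x B])
  moreover have "y \<bullet> (C *v y') = x \<bullet> (\<Gamma> *v y) - y \<bullet> (G *v y)"
    using inner_matrix_vector_transpose[of y "transpose \<Gamma>" x]
    by (simp add: eq_y' inner_diff_right inner_commute)
  moreover have "ki *\<^sub>R (u - ub) + transpose B *v x = \<mu> - kd *\<^sub>R v"
    by (simp add: control)
  then have "ki * ((u - ub) \<bullet> v) + (transpose B *v x) \<bullet> v = \<mu> \<bullet> v - kd * (v \<bullet> v)"
    by (metis inner_add_left inner_diff_left inner_scaleR_left)
  ultimately show ?thesis
    by linarith
qed

lemma storage_has_real_derivative:
  fixes L R :: "real^'s^'s" and C G :: "real^'r^'r" and \<Gamma> :: "real^'r^'s" and B :: "real^'m^'s"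
  assumes "transpose L = L" "transpose C = C"
    and x': "(x has_vector_derivative x') (at t within T)"
    and y': "(y has_vector_derivative y') (at t within T)"
    and u': "(u has_vector_derivative v) (at t within T)"
    and eq_x': "- (L *v x') = \<Gamma> *v y t + R *v x t - B *v v"
    and eq_y': "C *v y' = transpose \<Gamma> *v x t - G *v y t"
    and control: "kd *\<^sub>R v = \<mu> - ki *\<^sub>R (u t - ub) - transpose B *v x t"
  shows "((\<lambda>\<tau>. storage L C ki ub (x \<tau>) (y \<tau>) (u \<tau>)) has_real_derivative
           \<mu> \<bullet> v - kd * (v \<bullet> v) - x t \<bullet> (R *v x t) - y t \<bullet> (G *v y t)) (at t within T)"
proof -
  have w': "((\<lambda>\<tau>. u \<tau> - ub) has_vector_derivative v) (at t within T)"
    using u' by (simp add: has_vector_derivative_diff_const)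
  have deriv: "((\<lambda>\<tau>. storage L C ki ub (x \<tau>) (y \<tau>) (u \<tau>)) has_real_derivative
      (2 * (x t \<bullet> (L *v x')) + 2 * (y t \<bullet> (C *v y')) + ki * ((u t - ub) \<bullet> v + v \<bullet> (u t - ub))) / 2)
      (at t within T)"
    unfolding storage_def
    by (intro DERIV_cdivide DERIV_add DERIV_cmult has_real_derivative_inner w'
        has_real_derivative_quadratic_form assms(1,2) x' y')
  have "ki * ((u t - ub) \<bullet> v + v \<bullet> (u t - ub)) = 2 * (ki * ((u t - ub) \<bullet> v))"
    by (simp add: inner_commute)
  with storage_power_balance[OF eq_x' eq_y' control]
  have "(2 * (x t \<bullet> (L *v x')) + 2 * (y t \<bullet> (C *v y'))
      + ki * ((u t - ub) \<bullet> v + v \<bullet> (u t - ub))) / 2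
      = \<mu> \<bullet> v - kd * (v \<bullet> v) - x t \<bullet> (R *v x t) - y t \<bullet> (G *v y t)"
    by argo
  with deriv show ?thesis
    by (rule DERIV_cong)
qed

lemma closed_loop_sol_storage_dissipation:
  assumes "pos_def_mat L" "pos_def_mat C" "psd_mat R" "psd_mat G" "0 < kd"
    and "closed_loop_sol L C R G \<Gamma> B kd ki ub mu I V Jd Vd u" "0 \<le> t"
  shows "\<exists>D. ((\<lambda>\<tau>. storage L C ki ub (Jd \<tau>) (Vd \<tau>) (u \<tau>)) has_real_derivative D) (at t within {0..})
    \<and> D \<le> mu t \<bullet> ctrl_law kd ki ub B (mu t) (u t) (Jd t)"
proof -
  define v where "v = ctrl_law kd ki ub B (mu t) (u t) (Jd t)"
  obtain Jdd Vdd where sol: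
      "(Jd has_vector_derivative Jdd t) (at t within {0..})" "(Vd has_vector_derivative Vdd t) (at t within {0..})"
      "(u has_vector_derivative v) (at t within {0..})"
      "- (L *v Jdd t) = \<Gamma> *v Vd t + R *v Jd t - B *v v" "C *v Vdd t = transpose \<Gamma> *v Jd t - G *v Vd t"
    using assms(6,7) unfolding closed_loop_sol_def v_def by blast
  have "transpose L = L" "transpose C = C"
    using assms(1,2) by (simp_all add: pos_def_mat_def)
  then have "((\<lambda>\<tau>. storage L C ki ub (Jd \<tau>) (Vd \<tau>) (u \<tau>)) has_real_derivative
      mu t \<bullet> v - kd * (v \<bullet> v) - Jd t \<bullet> (R *v Jd t) - Vd t \<bullet> (G *v Vd t)) (at t within {0..})"
    using sol ctrl_law_scaled[of kd ki ub B "mu t" "u t" "Jd t"] assms(5)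
    by (intro storage_has_real_derivative) (simp_all add: v_def)
  moreover have "0 \<le> Jd t \<bullet> (R *v Jd t)" "0 \<le> Vd t \<bullet> (G *v Vd t)" "0 \<le> kd * (v \<bullet> v)"
    using assms(3-5) by (simp_all add: psd_mat_def)
  ultimately show ?thesis
    unfolding v_def[symmetric]
    by (intro exI[of _ "mu t \<bullet> v - kd * (v \<bullet> v) - Jd t \<bullet> (R *v Jd t) - Vd t \<bullet> (G *v Vd t)"]) auto
qed

lemma closed_loop_passive:
  assumes "pos_def_mat L" "pos_def_mat C" "psd_mat R" "psd_mat G" "0 < kd" "0 < ki"
  shows "\<exists>S :: (real^'s) \<times> (real^'r) \<times> (real^'s) \<times> (real^'r) \<times> (real^'m) \<Rightarrow> real.
    (\<forall>x. 0 \<le> S x) \<and>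
    (\<forall>mu I V Jd Vd u. closed_loop_sol L C R G \<Gamma> B kd ki ub mu I V Jd Vd u \<longrightarrow>
       (\<forall>t\<ge>0. \<exists>D. ((\<lambda>\<tau>. S (I \<tau>, V \<tau>, Jd \<tau>, Vd \<tau>, u \<tau>)) has_real_derivative D) (at t within {0..})
         \<and> D \<le> mu t \<bullet> ctrl_law kd ki ub B (mu t) (u t) (Jd t)))"
  using assms closed_loop_sol_storage_dissipation
  by (intro exI[of _ "\<lambda>(_, _, Jd, Vd, u). storage L C ki ub Jd Vd u"])
    (auto intro: storage_nonneg pos_def_mat_imp_psd_mat)

section \<open>The cross term\<close>

lemma cross_term_dissipative_part:
  fixes L R :: "real^'s^'s" and \<Gamma> :: "real^'r^'s"
  assumes eq_x': "- (L *v x') = \<Gamma> *v y + R *v x + f"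
    and "\<gamma> * norm y \<le> norm (\<Gamma> *v y)" "0 \<le> \<gamma>"
    and "norm (R *v x) \<le> \<kappa> * norm x" "norm (\<Gamma> *v y) \<le> \<kappa> * norm y" "0 \<le> \<kappa>"
    and "norm x \<le> k" "norm f \<le> k"
  shows "(L *v x') \<bullet> (\<Gamma> *v y) \<le> - \<gamma>\<^sup>2 * (norm y)\<^sup>2 + \<kappa> * (\<kappa> + 1) * (k * norm y)"
proof -
  have "(L *v x') \<bullet> (\<Gamma> *v y) = - ((\<Gamma> *v y) \<bullet> (\<Gamma> *v y)) - (R *v x + f) \<bullet> (\<Gamma> *v y)"
    using arg_cong[OF eq_x', of "\<lambda>z. z \<bullet> (\<Gamma> *v y)"] by (simp add: inner_add_left)
  moreover have "\<gamma>\<^sup>2 * (norm y)\<^sup>2 \<le> (\<Gamma> *v y) \<bullet> (\<Gamma> *v y)"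
    using power_mono[OF assms(2), of 2] assms(3) by (simp add: power2_norm_eq_inner power_mult_distrib)
  moreover have "\<kappa> * norm x \<le> \<kappa> * k"
    using assms(6,7) by (rule mult_left_mono[rotated])
  then have "norm (R *v x + f) \<le> (\<kappa> + 1) * k"
    using norm_triangle_ineq[of "R *v x" f] assms(4,8) by (simp add: algebra_simps)
  then have "- ((R *v x + f) \<bullet> (\<Gamma> *v y)) \<le> (\<kappa> + 1) * k * (\<kappa> * norm y)"
    using Cauchy_Schwarz_ineq2[of "R *v x + f" "\<Gamma> *v y"] assms(5)
    by (smt (verit) mult_mono norm_ge_zero)
  ultimately show ?thesis
    by (simp add: algebra_simps)
qed

lemma cross_term_coupling_part:
  fixes L :: "real^'s^'s" and C G :: "real^'r^'r" and \<Gamma> :: "real^'r^'s"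
  assumes eq_y': "C *v y' = transpose \<Gamma> *v x - G *v y + h"
    and "l * norm y' \<le> norm (C *v y')" "0 < l"
    and "norm (L *v x) \<le> \<kappa> * norm x" "norm (\<Gamma> *v y') \<le> \<kappa> * norm y'"
    and "norm (transpose \<Gamma> *v x) \<le> \<kappa> * norm x" "norm (G *v y) \<le> \<kappa> * norm y" "0 \<le> \<kappa>"
    and "norm x \<le> k" "norm h \<le> k"
  shows "(L *v x) \<bullet> (\<Gamma> *v y') \<le> \<kappa> * \<kappa> * (\<kappa> + 1) / l * (k * (k + norm y))"
proof -
  have \<kappa>x: "\<kappa> * norm x \<le> \<kappa> * k"
    using assms(8,9) by (rule mult_left_mono[rotated])
  have "l * norm y' \<le> norm (transpose \<Gamma> *v x - G *v y + h)"
    using assms(2) eq_y' by simp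
  also have "\<dots> \<le> \<kappa> * norm x + \<kappa> * norm y + norm h"
    using norm_triangle_ineq[of "transpose \<Gamma> *v x - G *v y" h]
      norm_triangle_ineq4[of "transpose \<Gamma> *v x" "G *v y"] assms(6,7)
    by linarith
  also have "\<dots> \<le> \<kappa> * k + \<kappa> * norm y + (k + norm y)"
    using \<kappa>x assms(10) norm_ge_zero[of y] by linarith
  also have "\<dots> = (\<kappa> + 1) * (k + norm y)"
    by (simp add: algebra_simps)
  finally have "norm y' \<le> (\<kappa> + 1) * (k + norm y) / l"
    using assms(3) by (simp add: field_simps)
  then have "(L *v x) \<bullet> (\<Gamma> *v y') \<le> (\<kappa> * k) * (\<kappa> * ((\<kappa> + 1) * (k + norm y) / l))"
    using Cauchy_Schwarz_ineq2[of "L *v x" "\<Gamma> *v y'"] assms(4,5,8) \<kappa>x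
    by (smt (verit) mult_left_mono mult_mono norm_ge_zero)
  also have "\<dots> = \<kappa> * \<kappa> * (\<kappa> + 1) / l * (k * (k + norm y))"
    by (simp add: field_simps)
  finally show ?thesis .
qed

lemma cross_term_bounds:
  fixes L R :: "real^'s^'s" and C G :: "real^'r^'r" and \<Gamma> :: "real^'r^'s"
  assumes "pos_def_mat C" and "inj ((*v) \<Gamma>)"
  obtains \<gamma> K where "0 < \<gamma>" "0 < K"
    "\<And>x y. \<bar>(L *v x) \<bullet> (\<Gamma> *v y)\<bar> \<le> K * (norm x * norm y)"
    "\<And>x y x' y' f h k. - (L *v x') = \<Gamma> *v y + R *v x + f \<Longrightarrow> C *v y' = transpose \<Gamma> *v x - G *v y + h \<Longrightarrow>
       norm x + norm f + norm h \<le> k \<Longrightarrow>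
       (L *v x) \<bullet> (\<Gamma> *v y') + (L *v x') \<bullet> (\<Gamma> *v y) \<le> - \<gamma> * (norm y)\<^sup>2 + K * k * (k + norm y)"
proof -
  obtain \<gamma> where \<gamma>: "0 < \<gamma>" "\<And>y. \<gamma> * norm y \<le> norm (\<Gamma> *v y)"
    using matrix_inj_norm_ge[OF assms(2)] by blast
  obtain l where l: "0 < l" "\<And>z. l * norm z \<le> norm (C *v z)"
    using matrix_inj_norm_ge[OF pos_def_mat_inj[OF assms(1)]] by blast
  define \<kappa> where "\<kappa> = 1 + onorm ((*v) L) + onorm ((*v) R) + onorm ((*v) \<Gamma>)
    + onorm ((*v) (transpose \<Gamma>)) + onorm ((*v) G)"
  note onorms = onorm_matrix_nonneg[of L] onorm_matrix_nonneg[of R] onorm_matrix_nonneg[of \<Gamma>]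
    onorm_matrix_nonneg[of "transpose \<Gamma>"] onorm_matrix_nonneg[of G]
  have "1 \<le> \<kappa>" "0 \<le> \<kappa>"
    unfolding \<kappa>_def using onorms by linarith+
  have L: "norm (L *v z) \<le> \<kappa> * norm z" and R: "norm (R *v z) \<le> \<kappa> * norm z"
    and \<Gamma>: "norm (\<Gamma> *v y) \<le> \<kappa> * norm y" and \<Gamma>t: "norm (transpose \<Gamma> *v z) \<le> \<kappa> * norm z"
    and G: "norm (G *v y) \<le> \<kappa> * norm y" for z y
    by (intro norm_matrix_vector_le; use onorms in \<open>simp add: \<kappa>_def\<close>)+
  define K where "K = \<kappa> * (\<kappa> + 1) + \<kappa> * \<kappa> * (\<kappa> + 1) / l"
  have "0 < K" "\<kappa> * \<kappa> \<le> K"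
    unfolding K_def using \<open>1 \<le> \<kappa>\<close> l(1) by (simp_all add: add_pos_nonneg algebra_simps)
  show ?thesis
  proof (rule that[of "\<gamma>\<^sup>2" K])
    show "0 < \<gamma>\<^sup>2" "0 < K"
      using \<gamma>(1) \<open>0 < K\<close> by simp_all
    show "\<bar>(L *v x) \<bullet> (\<Gamma> *v y)\<bar> \<le> K * (norm x * norm y)" for x y
      using Cauchy_Schwarz_ineq2[of "L *v x" "\<Gamma> *v y"] L[of x] \<Gamma>[of y] \<open>1 \<le> \<kappa>\<close>
        mult_right_mono[OF \<open>\<kappa> * \<kappa> \<le> K\<close>, of "norm x * norm y"]
      by (smt (verit) mult.assoc mult.left_commute mult_mono norm_ge_zero zero_le_mult_iff)
    fix x y x' y' f h k
    assume eq_x': "- (L *v x') = \<Gamma> *v y + R *v x + f"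
      and eq_y': "C *v y' = transpose \<Gamma> *v x - G *v y + h"
      and "norm x + norm f + norm h \<le> k"
    then have "0 \<le> k" "norm x \<le> k" "norm f \<le> k" "norm h \<le> k"
      using norm_ge_zero[of x] norm_ge_zero[of f] norm_ge_zero[of h] by linarith+
    have "\<kappa> * (\<kappa> + 1) * (k * norm y) \<le> \<kappa> * (\<kappa> + 1) * (k * (k + norm y))"
      using \<open>1 \<le> \<kappa>\<close> \<open>0 \<le> k\<close> by (intro mult_left_mono) (auto simp: algebra_simps)
    with cross_term_dissipative_part[OF eq_x' \<gamma>(2) less_imp_le[OF \<gamma>(1)] R \<Gamma> \<open>0 \<le> \<kappa>\<close>
        \<open>norm x \<le> k\<close> \<open>norm f \<le> k\<close>]
      cross_term_coupling_part[OF eq_y' l(2) l(1) L \<Gamma> \<Gamma>t G \<open>0 \<le> \<kappa>\<close> \<open>norm x \<le> k\<close> \<open>norm h \<le> k\<close>]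
    show "(L *v x) \<bullet> (\<Gamma> *v y') + (L *v x') \<bullet> (\<Gamma> *v y) \<le> - \<gamma>\<^sup>2 * (norm y)\<^sup>2 + K * k * (k + norm y)"
      unfolding K_def by (simp add: algebra_simps)
  qed
qed

section \<open>Convergence of the unforced closed loop\<close>

text \<open>
  The extended closed loop with mu = 0, in the variables x = dI/dt, y = dV/dt and u = u_s, with
  x', y' their derivatives and v = du_s/dt; only the differentiated circuit equations enter.
\<close>

locale extended_rlc_trajectory =
  fixes L R :: "real^'s^'s" and C G :: "real^'r^'r" and \<Gamma> :: "real^'r^'s" and B :: "real^'m^'s"
    and kd ki :: real and ub :: "real^'m"
    and x x' :: "real \<Rightarrow> real^'s" and y y' :: "real \<Rightarrow> real^'r" and u v :: "real \<Rightarrow> real^'m"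
  assumes L: "pos_def_mat L" and C: "pos_def_mat C" and R: "psd_mat R" and G: "psd_mat G"
    and kd: "0 < kd" and ki: "0 < ki"
    and x': "\<And>t. 0 \<le> t \<Longrightarrow> (x has_vector_derivative x' t) (at t within {0..})"
    and y': "\<And>t. 0 \<le> t \<Longrightarrow> (y has_vector_derivative y' t) (at t within {0..})"
    and u': "\<And>t. 0 \<le> t \<Longrightarrow> (u has_vector_derivative v t) (at t within {0..})"
    and eq_x': "\<And>t. 0 \<le> t \<Longrightarrow> - (L *v x' t) = \<Gamma> *v y t + R *v x t - B *v v t"
    and eq_y': "\<And>t. 0 \<le> t \<Longrightarrow> C *v y' t = transpose \<Gamma> *v x t - G *v y t"
    and control: "\<And>t. 0 \<le> t \<Longrightarrow> kd *\<^sub>R v t = - ki *\<^sub>R (u t - ub) - transpose B *v x t"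
begin

definition energy :: "real \<Rightarrow> real"
  where "energy t = storage L C ki ub (x t) (y t) (u t)"

definition \<beta> :: real
  where "\<beta> = 1 + onorm ((*v) B)"

lemma \<beta>_pos: "0 < \<beta>"
  using onorm_matrix_nonneg[of B] unfolding \<beta>_def by linarith

lemma norm_B_le: "norm (B *v z) \<le> \<beta> * norm z"
  by (rule norm_matrix_vector_le) (simp add: \<beta>_def)

definition dissipation :: "real \<Rightarrow> real"
  where "dissipation t = kd * (v t \<bullet> v t) + x t \<bullet> (R *v x t) + y t \<bullet> (G *v y t)"

lemma energy_has_real_derivative:
  assumes "0 \<le> t"
  shows "(energy has_real_derivative - dissipation t) (at t within {0..})"
proof -
  have "transpose L = L" "transpose C = C"
    using L C by (simp_all add: pos_def_mat_def)
  moreover have "kd *\<^sub>R v t = 0 - ki *\<^sub>R (u t - ub) - transpose B *v x t"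
    using control[OF assms] by simp
  ultimately have "((\<lambda>\<tau>. storage L C ki ub (x \<tau>) (y \<tau>) (u \<tau>)) has_real_derivative
      0 \<bullet> v t - kd * (v t \<bullet> v t) - x t \<bullet> (R *v x t) - y t \<bullet> (G *v y t)) (at t within {0..})"
    by (rule storage_has_real_derivative[OF _ _ x'[OF assms] y'[OF assms] u'[OF assms] eq_x'[OF assms]
        eq_y'[OF assms]])
  then show ?thesis
    unfolding energy_def[abs_def] dissipation_def by simp
qed

lemma energy_nonneg: "0 \<le> energy t"
  unfolding energy_def using L C ki by (intro storage_nonneg pos_def_mat_imp_psd_mat) auto

lemma energy_ge_norm:
  obtains l where "0 < l" "\<And>t. l * (norm (x t, y t, u t - ub))\<^sup>2 \<le> energy t"
proof -
  obtain l where "0 < l" "\<And>x y u. l * (norm (x, y, u - ub))\<^sup>2 \<le> storage L C ki ub x y u"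
    using storage_ge_norm[OF L C ki] by blast
  then show ?thesis
    using that unfolding energy_def by blast
qed

lemma energy_le:
  obtains c where "0 < c"
    "\<And>t. 0 \<le> t \<Longrightarrow> energy t \<le> c * (norm (x t) + norm (y t) + \<beta> * norm (v t))\<^sup>2"
proof -
  obtain c where c: "0 < c" "\<And>x y u v. kd *\<^sub>R v = - ki *\<^sub>R (u - ub) - transpose B *v x \<Longrightarrow>
      storage L C ki ub x y u \<le> c * (norm x + norm y + \<beta> * norm v)\<^sup>2"
    using storage_le_under_control[OF kd ki \<beta>_pos] by blast
  show ?thesis
  proof (rule that[OF c(1)])
    show "energy t \<le> c * (norm (x t) + norm (y t) + \<beta> * norm (v t))\<^sup>2" if "0 \<le> t" for t
      unfolding energy_def by (rule c(2)[OF control[OF that]])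
  qed
qed

lemma energy_ge_norm_mult:
  obtains l where "0 < l" "\<And>t. l * (norm (x t) * norm (y t)) \<le> energy t"
proof -
  obtain l where l: "0 < l" "\<And>t. l * (norm (x t, y t, u t - ub))\<^sup>2 \<le> energy t"
    using energy_ge_norm by blast
  have "norm (x t) * norm (y t) \<le> (norm (x t, y t, u t - ub))\<^sup>2" for t
    unfolding power2_eq_square
    using norm_fst_le[of "x t" "(y t, u t - ub)"] norm_fst_le[of "y t" "u t - ub"]
      norm_snd_le[of "(y t, u t - ub)" "x t"]
    by (intro mult_mono) auto
  then show ?thesis
    using that[OF l(1)] l(2) by (meson l(1) mult_left_mono order_trans less_imp_le)
qed

lemma kd_inner_v: "kd * (v t \<bullet> v t) = kd / \<beta>\<^sup>2 * (\<beta> * norm (v t))\<^sup>2"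
  using \<beta>_pos by (simp add: power2_norm_eq_inner power_mult_distrib)

lemma dissipation_ge_if_R_pos_def:
  assumes "pos_def_mat R"
  obtains d where "0 < d" "\<And>t. d * (norm (x t) + \<beta> * norm (v t))\<^sup>2 \<le> dissipation t"
proof -
  obtain r where r: "0 < r" "\<And>z. r * (norm z)\<^sup>2 \<le> z \<bullet> (R *v z)"
    using pos_def_mat_quadratic_ge[OF assms] by blast
  have "min r (kd / \<beta>\<^sup>2) / 2 * (norm (x t) + \<beta> * norm (v t))\<^sup>2 \<le> dissipation t" for t
  proof -
    have "min r (kd / \<beta>\<^sup>2) / 2 * (norm (x t) + \<beta> * norm (v t))\<^sup>2
        \<le> r * (norm (x t))\<^sup>2 + kd / \<beta>\<^sup>2 * (\<beta> * norm (v t))\<^sup>2"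
      using r(1) kd \<beta>_pos by (intro weighted_sum_sq_ge) simp_all
    also have "\<dots> \<le> dissipation t"
      using r(2)[of "x t"] G kd_inner_v[of t] unfolding dissipation_def psd_mat_def
      by (simp add: add_increasing2)
    finally show ?thesis .
  qed
  moreover have "0 < min r (kd / \<beta>\<^sup>2) / 2"
    using r(1) kd \<beta>_pos by simp
  ultimately show ?thesis
    using that by blast
qed

lemma dissipation_ge_if_G_pos_def:
  assumes "pos_def_mat G"
  obtains d where "0 < d" "\<And>t. d * (norm (y t) + \<beta> * norm (v t))\<^sup>2 \<le> dissipation t"
proof -
  obtain q where q: "0 < q" "\<And>z. q * (norm z)\<^sup>2 \<le> z \<bullet> (G *v z)"
    using pos_def_mat_quadratic_ge[OF assms] by blast
  have "min q (kd / \<beta>\<^sup>2) / 2 * (norm (y t) + \<beta> * norm (v t))\<^sup>2 \<le> dissipation t" for t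
  proof -
    have "min q (kd / \<beta>\<^sup>2) / 2 * (norm (y t) + \<beta> * norm (v t))\<^sup>2
        \<le> q * (norm (y t))\<^sup>2 + kd / \<beta>\<^sup>2 * (\<beta> * norm (v t))\<^sup>2"
      using q(1) kd \<beta>_pos by (intro weighted_sum_sq_ge) simp_all
    also have "\<dots> \<le> dissipation t"
      using q(2)[of "y t"] R kd_inner_v[of t] unfolding dissipation_def psd_mat_def
      by (simp add: add_increasing)
    finally show ?thesis .
  qed
  moreover have "0 < min q (kd / \<beta>\<^sup>2) / 2"
    using q(1) kd \<beta>_pos by simp
  ultimately show ?thesis
    using that by blast
qed

lemma dissipation_ge_if_R_G_pos_def:
  assumes "pos_def_mat R" "pos_def_mat G"
  obtains d where "0 < d" "\<And>t. d * (norm (x t) + norm (y t) + \<beta> * norm (v t))\<^sup>2 \<le> dissipation t"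
proof -
  obtain r where r: "0 < r" "\<And>z. r * (norm z)\<^sup>2 \<le> z \<bullet> (R *v z)"
    using pos_def_mat_quadratic_ge[OF assms(1)] by blast
  obtain q where q: "0 < q" "\<And>z. q * (norm z)\<^sup>2 \<le> z \<bullet> (G *v z)"
    using pos_def_mat_quadratic_ge[OF assms(2)] by blast
  define d where "d = min r (min q (kd / \<beta>\<^sup>2)) / 3"
  have "d * (norm (x t) + norm (y t) + \<beta> * norm (v t))\<^sup>2 \<le> dissipation t" for t
  proof -
    have "d * (norm (x t) + norm (y t) + \<beta> * norm (v t))\<^sup>2
        \<le> r * (norm (x t))\<^sup>2 + q * (norm (y t))\<^sup>2 + kd / \<beta>\<^sup>2 * (\<beta> * norm (v t))\<^sup>2"
      unfolding d_def using r(1) q(1) kd \<beta>_pos by (intro weighted_sum_sq_ge3) simp_all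
    also have "\<dots> \<le> dissipation t"
      using r(2)[of "x t"] q(2)[of "y t"] kd_inner_v[of t] unfolding dissipation_def by simp
    finally show ?thesis .
  qed
  moreover have "0 < d"
    unfolding d_def using r(1) q(1) kd \<beta>_pos by simp
  ultimately show ?thesis
    using that by blast
qed

lemma energy_tendsto_zero_if_R_G_pos_def:
  assumes "pos_def_mat R" "pos_def_mat G"
  shows "(energy \<longlongrightarrow> 0) at_top"
proof -
  obtain c where c: "0 < c" "\<And>t. 0 \<le> t \<Longrightarrow> energy t \<le> c * (norm (x t) + norm (y t) + \<beta> * norm (v t))\<^sup>2"
    using energy_le by blast
  obtain d where d: "0 < d" "\<And>t. d * (norm (x t) + norm (y t) + \<beta> * norm (v t))\<^sup>2 \<le> dissipation t"
    using dissipation_ge_if_R_G_pos_def[OF assms] by blast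
  show ?thesis
  proof (rule strict_lyapunov_tendsto_zero[where S = energy and W = "\<lambda>_. 0" and W' = "\<lambda>_. 0"
        and m = "\<lambda>_. 0" and k = "\<lambda>t. norm (x t) + norm (y t) + \<beta> * norm (v t)"
        and a = 0 and b = c and d = d and g = 1 and K = 0])
    fix t :: real
    assume "0 \<le> t"
    show "(energy has_real_derivative - dissipation t) (at t within {0..})"
      using energy_has_real_derivative[OF \<open>0 \<le> t\<close>] .
    show "- dissipation t \<le> - d * (norm (x t) + norm (y t) + \<beta> * norm (v t))\<^sup>2"
      using d(2)[of t] by simp
    show "energy t \<le> c * (norm (x t) + norm (y t) + \<beta> * norm (v t) + 0)\<^sup>2"
      using c(2)[OF \<open>0 \<le> t\<close>] by simp
    show "0 \<le> norm (x t) + norm (y t) + \<beta> * norm (v t)"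
      using \<beta>_pos by simp
    show "0 \<le> energy t"
      by (rule energy_nonneg)
    show "((\<lambda>_. 0) has_real_derivative 0) (at t within {0..})"
      by (rule DERIV_const)
  qed (use c(1) d(1) in auto)
qed

lemma energy_tendsto_zero_if_R_pos_def:
  assumes "pos_def_mat R" "inj ((*v) \<Gamma>)"
  shows "(energy \<longlongrightarrow> 0) at_top"
proof -
  obtain \<gamma> K where \<gamma>: "0 < \<gamma>" and "0 < K"
    and W_le: "\<And>x y. \<bar>(L *v x) \<bullet> (\<Gamma> *v y)\<bar> \<le> K * (norm x * norm y)"
    and W'_le: "\<And>x y x' y' f h k. - (L *v x') = \<Gamma> *v y + R *v x + f \<Longrightarrow>
      C *v y' = transpose \<Gamma> *v x - G *v y + h \<Longrightarrow> norm x + norm f + norm h \<le> k \<Longrightarrow>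
      (L *v x) \<bullet> (\<Gamma> *v y') + (L *v x') \<bullet> (\<Gamma> *v y) \<le> - \<gamma> * (norm y)\<^sup>2 + K * k * (k + norm y)"
    using cross_term_bounds[where L = L and R = R and G = G, OF C assms(2)] by blast
  obtain l where l: "0 < l" "\<And>t. l * (norm (x t) * norm (y t)) \<le> energy t"
    using energy_ge_norm_mult by blast
  obtain c where c: "0 < c" "\<And>t. 0 \<le> t \<Longrightarrow> energy t \<le> c * (norm (x t) + norm (y t) + \<beta> * norm (v t))\<^sup>2"
    using energy_le by blast
  obtain d where d: "0 < d" "\<And>t. d * (norm (x t) + \<beta> * norm (v t))\<^sup>2 \<le> dissipation t"
    using dissipation_ge_if_R_pos_def[OF assms(1)] by blast
  show ?thesis
  proof (rule strict_lyapunov_tendsto_zero[where S = energy and W = "\<lambda>t. (L *v x t) \<bullet> (\<Gamma> *v y t)"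
        and W' = "\<lambda>t. (L *v x t) \<bullet> (\<Gamma> *v y' t) + (L *v x' t) \<bullet> (\<Gamma> *v y t)"
        and k = "\<lambda>t. norm (x t) + \<beta> * norm (v t)" and m = "\<lambda>t. norm (y t)"
        and a = "K / l" and b = c and d = d and g = \<gamma> and K = K])
    fix t :: real
    assume "0 \<le> t"
    show "(energy has_real_derivative - dissipation t) (at t within {0..})"
      using energy_has_real_derivative[OF \<open>0 \<le> t\<close>] .
    show "((\<lambda>t. (L *v x t) \<bullet> (\<Gamma> *v y t)) has_real_derivative
        (L *v x t) \<bullet> (\<Gamma> *v y' t) + (L *v x' t) \<bullet> (\<Gamma> *v y t)) (at t within {0..})"
      using x' y' \<open>0 \<le> t\<close> by (intro has_real_derivative_inner has_vector_derivative_matrix_vector_mult)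
    show "- dissipation t \<le> - d * (norm (x t) + \<beta> * norm (v t))\<^sup>2"
      using d(2)[of t] by simp
    show "energy t \<le> c * (norm (x t) + \<beta> * norm (v t) + norm (y t))\<^sup>2"
      using c(2)[OF \<open>0 \<le> t\<close>] by (simp add: ac_simps)
    show "\<bar>(L *v x t) \<bullet> (\<Gamma> *v y t)\<bar> \<le> K / l * energy t"
      using W_le[of "x t" "y t"] mult_left_mono[OF l(2)[of t], of "K / l"] \<open>0 < K\<close> l(1) by simp
    show "(L *v x t) \<bullet> (\<Gamma> *v y' t) + (L *v x' t) \<bullet> (\<Gamma> *v y t)
        \<le> - \<gamma> * (norm (y t))\<^sup>2 + K * (norm (x t) + \<beta> * norm (v t)) * (norm (x t) + \<beta> * norm (v t) + norm (y t))"
      using eq_x'[OF \<open>0 \<le> t\<close>] eq_y'[OF \<open>0 \<le> t\<close>] norm_B_le[of "v t"]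
      by (intro W'_le[where f = "- (B *v v t)" and h = 0]) simp_all
    show "0 \<le> norm (x t) + \<beta> * norm (v t)"
      using \<beta>_pos by simp
    show "0 \<le> energy t"
      by (rule energy_nonneg)
  qed (use \<open>0 < K\<close> l(1) c(1) d(1) \<gamma> in auto)
qed

lemma energy_tendsto_zero_if_G_pos_def:
  assumes "pos_def_mat G" "inj ((*v) (transpose \<Gamma>))"
  shows "(energy \<longlongrightarrow> 0) at_top"
proof -
  \<comment> \<open>The cross-term estimate with the roles of (L, R, x) and (C, G, y) exchanged, applied to (y, -x).\<close>
  obtain \<gamma> K where \<gamma>: "0 < \<gamma>" and "0 < K"
    and W_le: "\<And>x y. \<bar>(C *v x) \<bullet> (transpose \<Gamma> *v y)\<bar> \<le> K * (norm x * norm y)"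
    and W'_le: "\<And>x y x' y' f h k. - (C *v x') = transpose \<Gamma> *v y + G *v x + f \<Longrightarrow>
      L *v y' = transpose (transpose \<Gamma>) *v x - R *v y + h \<Longrightarrow> norm x + norm f + norm h \<le> k \<Longrightarrow>
      (C *v x) \<bullet> (transpose \<Gamma> *v y') + (C *v x') \<bullet> (transpose \<Gamma> *v y)
        \<le> - \<gamma> * (norm y)\<^sup>2 + K * k * (k + norm y)"
    using cross_term_bounds[where L = C and R = G and G = R, OF L assms(2)] by blast
  obtain l where l: "0 < l" "\<And>t. l * (norm (x t) * norm (y t)) \<le> energy t"
    using energy_ge_norm_mult by blast
  obtain c where c: "0 < c" "\<And>t. 0 \<le> t \<Longrightarrow> energy t \<le> c * (norm (x t) + norm (y t) + \<beta> * norm (v t))\<^sup>2"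
    using energy_le by blast
  obtain d where d: "0 < d" "\<And>t. d * (norm (y t) + \<beta> * norm (v t))\<^sup>2 \<le> dissipation t"
    using dissipation_ge_if_G_pos_def[OF assms(1)] by blast
  show ?thesis
  proof (rule strict_lyapunov_tendsto_zero[where S = energy
        and W = "\<lambda>t. (C *v y t) \<bullet> (transpose \<Gamma> *v - x t)"
        and W' = "\<lambda>t. (C *v y t) \<bullet> (transpose \<Gamma> *v - x' t) + (C *v y' t) \<bullet> (transpose \<Gamma> *v - x t)"
        and k = "\<lambda>t. norm (y t) + \<beta> * norm (v t)" and m = "\<lambda>t. norm (x t)"
        and a = "K / l" and b = c and d = d and g = \<gamma> and K = K])
    fix t :: real
    assume "0 \<le> t"
    show "(energy has_real_derivative - dissipation t) (at t within {0..})"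
      using energy_has_real_derivative[OF \<open>0 \<le> t\<close>] .
    show "((\<lambda>t. (C *v y t) \<bullet> (transpose \<Gamma> *v - x t)) has_real_derivative
        (C *v y t) \<bullet> (transpose \<Gamma> *v - x' t) + (C *v y' t) \<bullet> (transpose \<Gamma> *v - x t)) (at t within {0..})"
      using x' y' \<open>0 \<le> t\<close>
      by (intro has_real_derivative_inner has_vector_derivative_matrix_vector_mult has_vector_derivative_minus)
    show "- dissipation t \<le> - d * (norm (y t) + \<beta> * norm (v t))\<^sup>2"
      using d(2)[of t] by simp
    show "energy t \<le> c * (norm (y t) + \<beta> * norm (v t) + norm (x t))\<^sup>2"
      using c(2)[OF \<open>0 \<le> t\<close>] by (simp add: ac_simps)
    show "\<bar>(C *v y t) \<bullet> (transpose \<Gamma> *v - x t)\<bar> \<le> K / l * energy t"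
      using W_le[of "y t" "- x t"] mult_left_mono[OF l(2)[of t], of "K / l"] \<open>0 < K\<close> l(1)
      by (simp add: mult.commute)
    show "(C *v y t) \<bullet> (transpose \<Gamma> *v - x' t) + (C *v y' t) \<bullet> (transpose \<Gamma> *v - x t)
        \<le> - \<gamma> * (norm (x t))\<^sup>2 + K * (norm (y t) + \<beta> * norm (v t)) * (norm (y t) + \<beta> * norm (v t) + norm (x t))"
      using eq_x'[OF \<open>0 \<le> t\<close>] eq_y'[OF \<open>0 \<le> t\<close>] norm_B_le[of "v t"]
        W'_le[where x = "y t" and y = "- x t" and x' = "y' t" and y' = "- x' t" and f = 0 and h = "- (B *v v t)"]
      by (simp add: vec.neg)
    show "0 \<le> norm (y t) + \<beta> * norm (v t)"
      using \<beta>_pos by simp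
    show "0 \<le> energy t"
      by (rule energy_nonneg)
  qed (use \<open>0 < K\<close> l(1) c(1) d(1) \<gamma> in auto)
qed

lemma energy_tendsto_zero:
  assumes "(pos_def_mat R \<and> pos_def_mat G) \<or> (pos_def_mat R \<and> rank \<Gamma> = CARD('r))
    \<or> (pos_def_mat G \<and> rank (transpose \<Gamma>) = CARD('s))"
  shows "(energy \<longlongrightarrow> 0) at_top"
  using assms unfolding full_rank_injective
  by (auto intro: energy_tendsto_zero_if_R_G_pos_def energy_tendsto_zero_if_R_pos_def
      energy_tendsto_zero_if_G_pos_def)

lemma error_tendsto_zero:
  assumes "(pos_def_mat R \<and> pos_def_mat G) \<or> (pos_def_mat R \<and> rank \<Gamma> = CARD('r))
    \<or> (pos_def_mat G \<and> rank (transpose \<Gamma>) = CARD('s))"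
  shows "((\<lambda>t. (x t, y t, u t - ub)) \<longlongrightarrow> 0) at_top"
proof -
  obtain l where l: "0 < l" "\<And>t. l * (norm (x t, y t, u t - ub))\<^sup>2 \<le> energy t"
    using energy_ge_norm by blast
  have "((\<lambda>t. (norm (x t, y t, u t - ub))\<^sup>2) \<longlongrightarrow> 0) at_top"
  proof (rule tendsto_sandwich[OF _ _ tendsto_const])
    show "\<forall>\<^sub>F t in at_top. 0 \<le> (norm (x t, y t, u t - ub))\<^sup>2"
      by simp
    show "\<forall>\<^sub>F t in at_top. (norm (x t, y t, u t - ub))\<^sup>2 \<le> energy t / l"
      using l by (simp add: pos_le_divide_eq mult.commute)
    show "((\<lambda>t. energy t / l) \<longlongrightarrow> 0) at_top"
      by (rule tendsto_divide_zero[OF energy_tendsto_zero[OF assms]])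
  qed
  then have "((\<lambda>t. sqrt ((norm (x t, y t, u t - ub))\<^sup>2)) \<longlongrightarrow> sqrt 0) at_top"
    by (rule tendsto_real_sqrt)
  then have "((\<lambda>t. norm (x t, y t, u t - ub)) \<longlongrightarrow> 0) at_top"
    by simp
  then show ?thesis
    by (simp add: tendsto_norm_zero_iff)
qed

end

lemma closed_loop_sol_imp_extended_rlc_trajectory:
  assumes "pos_def_mat L" "pos_def_mat C" "psd_mat R" "psd_mat G" "0 < kd" "0 < ki"
    and "closed_loop_sol L C R G \<Gamma> B kd ki ub (\<lambda>_. 0) I V Jd Vd u"
  obtains Jdd Vdd
  where "extended_rlc_trajectory L R C G \<Gamma> B kd ki ub Jd Jdd Vd Vdd u (\<lambda>t. ctrl_law kd ki ub B 0 (u t) (Jd t))"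
proof -
  obtain Jdd Vdd where sol: "\<forall>t\<ge>0.
       (Jd has_vector_derivative Jdd t) (at t within {0..}) \<and>
       (Vd has_vector_derivative Vdd t) (at t within {0..}) \<and>
       (u has_vector_derivative ctrl_law kd ki ub B 0 (u t) (Jd t)) (at t within {0..}) \<and>
       - (L *v Jdd t) = \<Gamma> *v Vd t + R *v Jd t - B *v ctrl_law kd ki ub B 0 (u t) (Jd t) \<and>
       C *v Vdd t = transpose \<Gamma> *v Jd t - G *v Vd t"
    using assms(7) unfolding closed_loop_sol_def by blast
  have "extended_rlc_trajectory L R C G \<Gamma> B kd ki ub Jd Jdd Vd Vdd u (\<lambda>t. ctrl_law kd ki ub B 0 (u t) (Jd t))"
    using assms(1-6) sol ctrl_law_scaled[of kd ki ub B 0] by unfold_locales auto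
  then show ?thesis
    by (rule that)
qed

lemma closed_loop_sol_error_tendsto_zero:
  fixes L R :: "real^'s^'s" and C G :: "real^'r^'r" and \<Gamma> :: "real^'r^'s" and B :: "real^'m^'s"
  assumes "pos_def_mat L" "pos_def_mat C" "psd_mat R" "psd_mat G" "0 < kd" "0 < ki"
    and "(pos_def_mat R \<and> pos_def_mat G) \<or> (pos_def_mat R \<and> rank \<Gamma> = CARD('r))
      \<or> (pos_def_mat G \<and> rank (transpose \<Gamma>) = CARD('s))"
    and "closed_loop_sol L C R G \<Gamma> B kd ki ub (\<lambda>_. 0) I V Jd Vd u"
  shows "((\<lambda>t. (Jd t, Vd t, u t - ub)) \<longlongrightarrow> 0) at_top"
proof -
  obtain Jdd Vdd
    where "extended_rlc_trajectory L R C G \<Gamma> B kd ki ub Jd Jdd Vd Vdd u (\<lambda>t. ctrl_law kd ki ub B 0 (u t) (Jd t))"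
    using closed_loop_sol_imp_extended_rlc_trajectory[OF assms(1-6,8)] by blast
  from extended_rlc_trajectory.error_tendsto_zero[OF this assms(7)] show ?thesis .
qed

lemma closed_loop_sol_infdist_tendsto_zero:
  fixes L R :: "real^'s^'s" and C G :: "real^'r^'r" and \<Gamma> :: "real^'r^'s" and B :: "real^'m^'s"
  assumes "pos_def_mat L" "pos_def_mat C" "psd_mat R" "psd_mat G" "0 < kd" "0 < ki"
    and "(pos_def_mat R \<and> pos_def_mat G) \<or> (pos_def_mat R \<and> rank \<Gamma> = CARD('r))
      \<or> (pos_def_mat G \<and> rank (transpose \<Gamma>) = CARD('s))"
    and "closed_loop_sol L C R G \<Gamma> B kd ki ub (\<lambda>_. 0) I V Jd Vd u"
  shows "((\<lambda>t. infdist (I t, V t, Jd t, Vd t, u t)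
      {(I', V', Jd', Vd', u'). Vd' = 0 \<and> Jd' = 0 \<and> ctrl_law kd ki ub B 0 u' Jd' = 0 \<and> u' = ub}) \<longlongrightarrow> 0) at_top"
proof (rule tendsto_sandwich[OF _ _ tendsto_const tendsto_norm_zero[OF closed_loop_sol_error_tendsto_zero[OF assms]]])
  let ?E = "{(I', V', Jd', Vd', u'). Vd' = 0 \<and> Jd' = 0 \<and> ctrl_law kd ki ub B 0 u' Jd' = 0 \<and> u' = ub}"
  have "infdist (I t, V t, Jd t, Vd t, u t) ?E \<le> dist (I t, V t, Jd t, Vd t, u t) (I t, V t, 0, 0, ub)" for t
    by (rule infdist_le) (simp add: ctrl_law_def)
  then show "\<forall>\<^sub>F t in at_top. infdist (I t, V t, Jd t, Vd t, u t) ?E \<le> norm (Jd t, Vd t, u t - ub)"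
    by (simp add: dist_norm norm_Pair)
  show "\<forall>\<^sub>F t in at_top. 0 \<le> infdist (I t, V t, Jd t, Vd t, u t) ?E"
    by (simp add: infdist_nonneg)
qed

section \<open>Convergence to the operating point\<close>

definition stack :: "real^'s \<Rightarrow> real^'r \<Rightarrow> real^('s + 'r)"
  where "stack p q = (\<chi> i. case i of Inl a \<Rightarrow> p $ a | Inr b \<Rightarrow> q $ b)"

lemma stack_zero: "stack 0 0 = 0"
  by (simp add: stack_def vec_eq_iff split: sum.split)

lemma block_As_mult_stack:
  fixes R :: "real^'s^'s" and G :: "real^'r^'r" and \<Gamma> :: "real^'r^'s"
  shows "block_As R \<Gamma> G *v stack p q = stack (R *v p + \<Gamma> *v q) (transpose \<Gamma> *v p - G *v q)"
  unfolding vec_eq_iff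
proof
  fix i :: "'s + 'r"
  have "sum f UNIV = sum (\<lambda>a. f (Inl a)) UNIV + sum (\<lambda>b. f (Inr b)) UNIV" for f :: "'s + 'r \<Rightarrow> real"
    using sum.Plus[of "UNIV :: 's set" "UNIV :: 'r set" f] by (simp add: comp_def)
  then show "(block_As R \<Gamma> G *v stack p q) $ i = stack (R *v p + \<Gamma> *v q) (transpose \<Gamma> *v p - G *v q) $ i"
    by (cases i) (simp_all add: matrix_vector_mult_def block_As_def stack_def transpose_def sum_negf)
qed

lemma tendsto_stack_iff:
  "((\<lambda>t. stack (p t) (q t)) \<longlongrightarrow> stack a b) F \<longleftrightarrow> (p \<longlongrightarrow> a) F \<and> (q \<longlongrightarrow> b) F"
proof safe
  assume lim: "((\<lambda>t. stack (p t) (q t)) \<longlongrightarrow> stack a b) F"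
  show "(p \<longlongrightarrow> a) F"
    by (rule vec_tendstoI) (use tendsto_vec_nth[OF lim, of "Inl _"] in \<open>simp add: stack_def\<close>)
  show "(q \<longlongrightarrow> b) F"
    by (rule vec_tendstoI) (use tendsto_vec_nth[OF lim, of "Inr _"] in \<open>simp add: stack_def\<close>)
next
  assume "(p \<longlongrightarrow> a) F" "(q \<longlongrightarrow> b) F"
  then show "((\<lambda>t. stack (p t) (q t)) \<longlongrightarrow> stack a b) F"
    by (intro vec_tendstoI) (auto simp: stack_def intro: tendsto_vec_nth split: sum.split)
qed

lemma circuit_tendsto_equilibrium:
  fixes L R :: "real^'s^'s" and C G :: "real^'r^'r" and \<Gamma> :: "real^'r^'s" and B :: "real^'m^'s"
  assumes rank: "rank (block_As R \<Gamma> G) = CARD('s + 'r)"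
    and eq1: "0 = \<Gamma> *v Vstar + R *v Ib - B *v ub" and eq2: "0 = transpose \<Gamma> *v Ib - G *v Vstar"
    and circuit1: "\<forall>\<^sub>F t in F. - (L *v Jd t) = \<Gamma> *v V t + R *v I t - B *v u t"
    and circuit2: "\<forall>\<^sub>F t in F. C *v Vd t = transpose \<Gamma> *v I t - G *v V t"
    and "(Jd \<longlongrightarrow> 0) F" "(Vd \<longlongrightarrow> 0) F" "(u \<longlongrightarrow> ub) F"
  shows "(I \<longlongrightarrow> Ib) F \<and> (V \<longlongrightarrow> Vstar) F"
proof -
  have ev: "\<forall>\<^sub>F t in F. block_As R \<Gamma> G *v stack (I t - Ib) (V t - Vstar) = stack (B *v (u t - ub) - L *v Jd t) (C *v Vd t)"
    using circuit1 circuit2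
  proof eventually_elim
    case (elim t)
    have "R *v (I t - Ib) + \<Gamma> *v (V t - Vstar)
        = (\<Gamma> *v V t + R *v I t - B *v u t) - (\<Gamma> *v Vstar + R *v Ib - B *v ub) + B *v (u t - ub)"
      by (simp add: matrix_vector_mult_diff_distrib algebra_simps)
    also have "\<dots> = B *v (u t - ub) - L *v Jd t"
      unfolding elim(1)[symmetric] eq1[symmetric] by simp
    finally have "R *v (I t - Ib) + \<Gamma> *v (V t - Vstar) = B *v (u t - ub) - L *v Jd t" .
    moreover have "transpose \<Gamma> *v (I t - Ib) - G *v (V t - Vstar)
        = (transpose \<Gamma> *v I t - G *v V t) - (transpose \<Gamma> *v Ib - G *v Vstar)"
      by (simp add: matrix_vector_mult_diff_distrib algebra_simps)
    then have "transpose \<Gamma> *v (I t - Ib) - G *v (V t - Vstar) = C *v Vd t"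
      unfolding elim(2)[symmetric] eq2[symmetric] by simp
    ultimately show ?case
      by (simp only: block_As_mult_stack)
  qed
  have "((\<lambda>t. B *v (u t - ub) - L *v Jd t) \<longlongrightarrow> B *v (ub - ub) - L *v 0) F"
    "((\<lambda>t. C *v Vd t) \<longlongrightarrow> C *v 0) F"
    by (intro tendsto_intros assms(6-8))+
  then have "((\<lambda>t. stack (B *v (u t - ub) - L *v Jd t) (C *v Vd t)) \<longlongrightarrow> stack 0 0) F"
    unfolding tendsto_stack_iff by simp
  with ev have "((\<lambda>t. block_As R \<Gamma> G *v stack (I t - Ib) (V t - Vstar)) \<longlongrightarrow> 0) F"
    by (simp add: tendsto_cong stack_zero)
  then have "((\<lambda>t. stack (I t - Ib) (V t - Vstar)) \<longlongrightarrow> stack 0 0) F"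
    unfolding stack_zero using rank full_rank_injective by (blast intro: matrix_inj_tendsto_zero)
  then show ?thesis
    unfolding tendsto_stack_iff by (simp add: LIM_zero_iff)
qed

lemma closed_loop_sol_tendsto_equilibrium:
  fixes L R :: "real^'s^'s" and C G :: "real^'r^'r" and \<Gamma> :: "real^'r^'s" and B :: "real^'m^'s"
  assumes "pos_def_mat L" "pos_def_mat C" "psd_mat R" "psd_mat G" "0 < kd" "0 < ki"
    and "(pos_def_mat R \<and> pos_def_mat G) \<or> (pos_def_mat R \<and> rank \<Gamma> = CARD('r))
      \<or> (pos_def_mat G \<and> rank (transpose \<Gamma>) = CARD('s))"
    and "rank (block_As R \<Gamma> G) = CARD('s + 'r)"
    and "0 = \<Gamma> *v Vstar + R *v Ib - B *v ub" "0 = transpose \<Gamma> *v Ib - G *v Vstar"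
    and sol: "closed_loop_sol L C R G \<Gamma> B kd ki ub (\<lambda>_. 0) I V Jd Vd u"
  shows "((\<lambda>t. (I t, V t, Jd t, Vd t, u t)) \<longlongrightarrow> (Ib, Vstar, 0, 0, ub)) at_top"
proof -
  have error: "((\<lambda>t. (Jd t, Vd t, u t - ub)) \<longlongrightarrow> (0, 0, 0)) at_top"
    using closed_loop_sol_error_tendsto_zero[OF assms(1-7) sol] by (simp add: zero_prod_def)
  have Jd: "(Jd \<longlongrightarrow> 0) at_top"
    using tendsto_fst[OF error] by simp
  have Vd: "(Vd \<longlongrightarrow> 0) at_top"
    using tendsto_fst[OF tendsto_snd[OF error]] by simp
  have u: "(u \<longlongrightarrow> ub) at_top"
    using tendsto_snd[OF tendsto_snd[OF error]] by (simp add: LIM_zero_iff)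
  have circuit: "- (L *v Jd t) = \<Gamma> *v V t + R *v I t - B *v u t"
    "C *v Vd t = transpose \<Gamma> *v I t - G *v V t" if "0 \<le> t" for t
    using sol that unfolding closed_loop_sol_def by blast+
  have "\<forall>\<^sub>F t in at_top. - (L *v Jd t) = \<Gamma> *v V t + R *v I t - B *v u t"
    "\<forall>\<^sub>F t in at_top. C *v Vd t = transpose \<Gamma> *v I t - G *v V t"
    by (rule eventually_at_top_linorderI, erule circuit)+
  from circuit_tendsto_equilibrium[OF assms(8-10) this Jd Vd u]
  show ?thesis
    by (intro tendsto_Pair Jd Vd u) auto
qed

lemma equilibrium_closed_loop_sol:
  assumes "0 = \<Gamma> *v Vstar + R *v Ib - B *v ub" "0 = transpose \<Gamma> *v Ib - G *v Vstar"
  shows "closed_loop_sol L C R G \<Gamma> B kd ki ub (\<lambda>_. 0) (\<lambda>_. Ib) (\<lambda>_. Vstar) (\<lambda>_. 0) (\<lambda>_. 0) (\<lambda>_. ub)"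
  unfolding closed_loop_sol_def using assms
  by (intro exI[of _ "\<lambda>_. 0"] allI impI conjI) (simp_all add: ctrl_law_def)

lemma closed_loop_constant_sol_eq_equilibrium:
  fixes L R :: "real^'s^'s" and C G :: "real^'r^'r" and \<Gamma> :: "real^'r^'s" and B :: "real^'m^'s"
  assumes "pos_def_mat L" "pos_def_mat C" "psd_mat R" "psd_mat G" "0 < kd" "0 < ki"
    and "(pos_def_mat R \<and> pos_def_mat G) \<or> (pos_def_mat R \<and> rank \<Gamma> = CARD('r))
      \<or> (pos_def_mat G \<and> rank (transpose \<Gamma>) = CARD('s))"
    and "rank (block_As R \<Gamma> G) = CARD('s + 'r)"
    and "0 = \<Gamma> *v Vstar + R *v Ib - B *v ub" "0 = transpose \<Gamma> *v Ib - G *v Vstar"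
    and "closed_loop_sol L C R G \<Gamma> B kd ki ub (\<lambda>_. 0) (\<lambda>_. I0) (\<lambda>_. V0) (\<lambda>_. Jd0) (\<lambda>_. Vd0) (\<lambda>_. u0)"
  shows "(I0, V0, Jd0, Vd0, u0) = (Ib, Vstar, 0, 0, ub)"
  using closed_loop_sol_tendsto_equilibrium[OF assms] by (simp add: tendsto_const_iff)

theorem theorem3:
  fixes L :: "real^'s^'s" and R :: "real^'s^'s"
    and C :: "real^'r^'r" and G :: "real^'r^'r"
    and \<Gamma> :: "real^'r^'s" and B :: "real^'m^'s"
    and Vstar :: "real^'r" and ub :: "real^'m" and Ib :: "real^'s"
    and kd ki :: real
  assumes L: "pos_def_mat L" and C: "pos_def_mat C"
    and R: "psd_mat R" and G: "psd_mat G"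
    and B: "rank B = CARD('m)"
    and Vstar_pos: "\<forall>j. 0 < Vstar $ j"
    and eq1: "0 = \<Gamma> *v Vstar + R *v Ib - B *v ub"
    and eq2: "0 = transpose \<Gamma> *v Ib - G *v Vstar"
    and kd: "kd > 0" and ki: "ki > 0"
  shows
    \<comment> \<open>(a) passivity of mu_s |-> u_s'\<close>
    "(\<exists>S :: (real^'s) \<times> (real^'r) \<times> (real^'s) \<times> (real^'r) \<times> (real^'m) \<Rightarrow> real.
        (\<forall>x. 0 \<le> S x) \<and>
        (\<forall>mu I V Jd Vd u. closed_loop_sol L C R G \<Gamma> B kd ki ub mu I V Jd Vd u \<longrightarrow>
           (\<forall>t\<ge>0. \<exists>D. ((\<lambda>\<tau>. S (I \<tau>, V \<tau>, Jd \<tau>, Vd \<tau>, u \<tau>)) has_real_derivative D) (at t within {0..})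
                     \<and> D \<le> mu t \<bullet> ctrl_law kd ki ub B (mu t) (u t) (Jd t))))
     \<and>
     \<comment> \<open>(b) convergence to the set, for mu_s = 0\<close>
     ((pos_def_mat R \<and> pos_def_mat G) \<or> (pos_def_mat R \<and> rank \<Gamma> = CARD('r))
        \<or> (pos_def_mat G \<and> rank (transpose \<Gamma>) = CARD('s)) \<longrightarrow>
      (\<forall>I V Jd Vd u. closed_loop_sol L C R G \<Gamma> B kd ki ub (\<lambda>_. 0) I V Jd Vd u \<longrightarrow>
         ((\<lambda>t. infdist (I t, V t, Jd t, Vd t, u t)
              {(I', V', Jd', Vd', u'). Vd' = 0 \<and> Jd' = 0 \<and> ctrl_law kd ki ub B 0 u' Jd' = 0 \<and> u' = ub})
          \<longlongrightarrow> 0) at_top))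
     \<and>
     \<comment> \<open>(c) convergence to the unique operating point\<close>
     (((pos_def_mat R \<and> pos_def_mat G) \<or> (pos_def_mat R \<and> rank \<Gamma> = CARD('r))
        \<or> (pos_def_mat G \<and> rank (transpose \<Gamma>) = CARD('s)))
       \<and> rank (block_As R \<Gamma> G) = CARD('s + 'r) \<longrightarrow>
      (\<forall>I V Jd Vd u. closed_loop_sol L C R G \<Gamma> B kd ki ub (\<lambda>_. 0) I V Jd Vd u \<longrightarrow>
         ((\<lambda>t. (I t, V t, Jd t, Vd t, u t)) \<longlongrightarrow> (Ib, Vstar, 0, 0, ub)) at_top)
      \<and> closed_loop_sol L C R G \<Gamma> B kd ki ub (\<lambda>_. 0) (\<lambda>_. Ib) (\<lambda>_. Vstar) (\<lambda>_. 0) (\<lambda>_. 0) (\<lambda>_. ub)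
      \<and> (\<forall>I0 V0 Jd0 Vd0 u0.
           closed_loop_sol L C R G \<Gamma> B kd ki ub (\<lambda>_. 0) (\<lambda>_. I0) (\<lambda>_. V0) (\<lambda>_. Jd0) (\<lambda>_. Vd0) (\<lambda>_. u0)
           \<longrightarrow> (I0, V0, Jd0, Vd0, u0) = (Ib, Vstar, 0, 0, ub)))"
  apply (intro conjI impI allI)
  subgoal
    by (rule closed_loop_passive[OF L C R G kd ki])
  subgoal
    by (rule closed_loop_sol_infdist_tendsto_zero[OF L C R G kd ki])
  subgoal
    by (elim conjE) (rule closed_loop_sol_tendsto_equilibrium[OF L C R G kd ki _ _ eq1 eq2])
  subgoal
    by (rule equilibrium_closed_loop_sol[OF eq1 eq2])
  subgoal
    by (elim conjE) (rule closed_loop_constant_sol_eq_equilibrium[OF L C R G kd ki _ _ eq1 eq2])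
  done

end
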